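(* Let $0<\alpha<1$, let $r\ge 2$ be an integer, let $M,N\in\mathbb{R}^{n\times n}$ be constant matrices (not assumed to commute), and let $f:\mathbb{N}_1\to\mathbb{R}^n$ be a continuous function. Then the function $$z(k)=\int_{0}^{k}\mathbb{D}_{\alpha,\alpha,r}^{M,N}\big(k-r-\rho(s)\big)f(s)\,\nabla s$$ satisfies the nonhomogeneous Riemann-Liouville fractional delayed difference system $$\nabla_{-r}^{\alpha} z(k)=Mz(k)+Nz(k-r)+f(k),\quad k\in\mathbb{N}_1,$$ $$z(k)=0,\quad k\in\mathbb{N}_{1-r}^{0}.$$
   Context: Notation: for real $a,b$ with $b-a$ a positive integer, $\mathbb{N}_a=\{a,a+1,a+2,\dots\}$, $\mathbb{N}^a=\{\dots,a-2,a-1,a\}$, $\mathbb{N}_a^b=\{a,a+1,\dots,b\}$; $\rho(s)=s-1$. The nabla integral is $\int_a^b g(s)\nabla s=\sum_{s=a+1}^{b}g(s)$ for $b\in\mathbb{N}_a$ (equal to $0$ when $b=a$), and $\int_a^b g(s)\nabla s=-\int_b^a g(s)\nabla s=-\sum_{s=b+1}^{a}g(s)$ when $b<a$. The generalized rising function is $k^{\overline{\gamma}}=\Gamma(k+\gamma)/\Gamma(k)$, and the nabla fractional Taylor monomial of order $\gamma$ ($\gamma$ not a negative integer) is $H_\gamma(k,a)=\dfrac{(k-a)^{\overline{\gamma}}}{\Gamma(\gamma+1)}$. For $0<\alpha<1$ and a function $z$ on $\mathbb{N}_{a+1}$, the nabla Riemann-Liouville fractional difference of order $\alpha$ is $$\nabla_a^{\alpha}z(k)=\sum_{s=a+1}^{k}H_{-\alpha-1}(k,\rho(s))\,z(s),\quad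 k\in\mathbb{N}_{a}.$$ Let $\Theta$ and $I$ be the zero and identity $n\times n$ matrices. The matrices $Q(i,j)$ are defined by $Q(0,j)=\Theta$ for $j\ge0$, $Q(i,-1)=\Theta$ for $i\ge0$, $Q(1,0)=I$, $Q(1,j)=\Theta$ for $j\ge1$, and $Q(i+1,j)=MQ(i,j)+NQ(i,j-1)$ for $i\ge1$, $j\ge0$. The discrete delayed perturbation of the Mittag-Leffler matrix function is defined for integers $k$ by $$\mathbb{D}_{\alpha,\beta,r}^{M,N}(k)=\begin{cases}\Theta,& k\in\mathbb{N}^{-r-1},\\ I,& k=-r,\\ \sum_{i=0}^{\infty}M^iH_{i\alpha+\beta-1}(k,-r),& k\in\mathbb{N}_{1-r}^{0},\\ \sum_{i=0}^{\infty}\sum_{j=0}^{p}Q(i+1,j)\,H_{i\alpha+\beta-1}(k,(j-1)r),& k\in\mathbb{N}_{(p-1)r+1}^{pr},\ p\in\mathbb{N}_1.\end{cases}$$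
   Formalization: The series defining the Mittag-Leffler matrix function are assumed to converge at every k ≥ 1−r (for n=1, M=2 the series at k=1−r diverges, so z(1) is undefined), and f is extended by zero to s ≤ 0, where the integral for k<0 evaluates it. *)

theory Defs
  imports "HOL-Analysis.Analysis"
begin

text \<open>All arguments and end points are integers: the discrete domains $\mathbb{N}_a$,
  $\mathbb{N}^b$ and $\mathbb{N}_a^b$ are the integer intervals \<open>{a..}\<close>, \<open>{..b}\<close>
  and \<open>{a..b}\<close>.\<close>

definition rho :: "int \<Rightarrow> int" where
  "rho s = s - 1"

definition nabla_integral :: "int \<Rightarrow> int \<Rightarrow> (int \<Rightarrow> 'b) \<Rightarrow> 'b::ab_group_add" where
  "nabla_integral a b g =
     (if a \<le> b then (\<Sum>s\<in>{a+1..b}. g s) else - (\<Sum>s\<in>{b+1..a}. g s))"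

definition rising :: "real \<Rightarrow> real \<Rightarrow> real" where
  "rising k \<gamma> = Gamma (k + \<gamma>) / Gamma k"

definition taylor_monomial :: "real \<Rightarrow> int \<Rightarrow> int \<Rightarrow> real" where
  "taylor_monomial \<gamma> k a = rising (of_int (k - a)) \<gamma> / Gamma (\<gamma> + 1)"

definition RL_difference :: "real \<Rightarrow> int \<Rightarrow> (int \<Rightarrow> 'b) \<Rightarrow> int \<Rightarrow> 'b::real_vector" where
  "RL_difference \<alpha> a z k = (\<Sum>s\<in>{a+1..k}. taylor_monomial (-\<alpha> - 1) k (rho s) *\<^sub>R z s)"

text \<open>Matrix powers are defined here because the overloaded product \<open>*\<close> on \<open>real ^ 'n ^ 'n\<close>
  is componentwise.\<close>

primrec matrix_power :: "real ^ 'n ^ 'n \<Rightarrow> nat \<Rightarrow> real ^ 'n ^ 'n" where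
  "matrix_power M 0 = mat 1"
| "matrix_power M (Suc i) = M ** matrix_power M i"

text \<open>The second index of \<open>Q\<close> ranges over the integers \<open>j \<ge> -1\<close>; all negative \<open>j\<close> are
  treated like \<open>j = -1\<close>.\<close>

fun Q :: "real ^ 'n ^ 'n \<Rightarrow> real ^ 'n ^ 'n \<Rightarrow> nat \<Rightarrow> int \<Rightarrow> real ^ 'n ^ 'n" where
  "Q M N 0 j = 0"
| "Q M N (Suc 0) j = (if j = 0 then mat 1 else 0)"
| "Q M N (Suc (Suc i)) j =
     (if j < 0 then 0 else M ** Q M N (Suc i) j + N ** Q M N (Suc i) (j - 1))"

text \<open>For \<open>k \<ge> 1\<close> the block index \<open>p\<close>, given by \<open>(p - 1) * r + 1 \<le> k \<le> p * r\<close>, is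
  the ceiling of \<open>k / r\<close>.\<close>

definition block_index :: "int \<Rightarrow> int \<Rightarrow> int" where
  "block_index r k = \<lceil>of_int k / (of_int r :: real)\<rceil>"

lemma block_index_iff:
  assumes "r > 0"
  shows "block_index r k = p \<longleftrightarrow> (p - 1) * r + 1 \<le> k \<and> k \<le> p * r"
proof -
  have "block_index r k = p \<longleftrightarrow>
      of_int p - 1 < of_int k / (of_int r :: real) \<and> of_int k / (of_int r :: real) \<le> of_int p"
    unfolding block_index_def by (rule ceiling_eq_iff)
  also have "\<dots> \<longleftrightarrow> of_int ((p - 1) * r) < (of_int k :: real) \<and> (of_int k :: real) \<le> of_int (p * r)"
    using assms by (simp add: field_simps)
  also have "\<dots> \<longleftrightarrow> (p - 1) * r + 1 \<le> k \<and> k \<le> p * r"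
    unfolding of_int_less_iff of_int_le_iff by auto
  finally show ?thesis .
qed

text \<open>The \<open>i\<close>-th term of the infinite series giving the value at \<open>k \<ge> 1 - r\<close>.\<close>

definition delayed_ML_term ::
    "real \<Rightarrow> real \<Rightarrow> int \<Rightarrow> real ^ 'n ^ 'n \<Rightarrow> real ^ 'n ^ 'n \<Rightarrow> int \<Rightarrow> nat \<Rightarrow> real ^ 'n ^ 'n" where
  "delayed_ML_term \<alpha> \<beta> r M N k i =
     (if k \<le> 0
      then taylor_monomial (of_nat i * \<alpha> + \<beta> - 1) k (-r) *\<^sub>R matrix_power M i
      else (\<Sum>j\<in>{0..block_index r k}.
              taylor_monomial (of_nat i * \<alpha> + \<beta> - 1) k ((j - 1) * r) *\<^sub>R Q M N (i + 1) j))"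

definition delayed_ML ::
    "real \<Rightarrow> real \<Rightarrow> int \<Rightarrow> real ^ 'n ^ 'n \<Rightarrow> real ^ 'n ^ 'n \<Rightarrow> int \<Rightarrow> real ^ 'n ^ 'n" where
  "delayed_ML \<alpha> \<beta> r M N k =
     (if k \<le> -r - 1 then 0
      else if k = -r then mat 1
      else (\<Sum>i. delayed_ML_term \<alpha> \<beta> r M N k i))"

text \<open>The series need not converge: at \<open>k = 1 - r\<close> it is the Neumann series of \<open>M\<close>. The matrix
  function is meaningful exactly when the following holds.\<close>

definition delayed_ML_convergent ::
    "real \<Rightarrow> real \<Rightarrow> int \<Rightarrow> real ^ 'n ^ 'n \<Rightarrow> real ^ 'n ^ 'n \<Rightarrow> bool" where
  "delayed_ML_convergent \<alpha> \<beta> r M N \<longleftrightarrow> (\<forall>k\<ge>1 - r. summable (delayed_ML_term \<alpha> \<beta> r M N k))"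

text \<open>A function given on $\mathbb{N}_1$ only, extended by zero. For \<open>k < 0\<close> the signed integral
  from \<open>0\<close> to \<open>k\<close> evaluates its integrand at points \<open>s \<le> 0\<close>, where the forcing term is not
  given.\<close>

definition zero_extension :: "(int \<Rightarrow> 'b) \<Rightarrow> int \<Rightarrow> 'b::zero" where
  "zero_extension f s = (if s \<ge> 1 then f s else 0)"

end

theory Submission
  imports Defs
begin

text \<open>The Taylor monomial of order $a - 1$ at $k$ with base point $b$ is the coefficient of
  $x^{k-b-1}$ in $(1-x)^{-a}$, so the fractional difference is convolution with the coefficients of
  $(1-x)^\alpha$. The values of the Mittag-Leffler function, shifted by \<open>r - 1\<close>, have generating
  function $D(x) = \sum_{i,j} Q(i+1,j)\, x^{jr} (1-x)^{-(i+1)\alpha}$. Multiplying by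
  $(1-x)^\alpha$ lowers the exponent by one step in $i$, and the recursion for $Q$ then gives
  $(1-x)^\alpha D = I + M D + N x^r D$. Since \<open>z\<close> is the convolution of \<open>D\<close> with \<open>f\<close>, this is the
  claimed equation.\<close>

section \<open>Coefficients of binomial series and Taylor monomials\<close>

text \<open>The coefficient of $x^m$ in $(1-x)^{-a}$.\<close>

definition neg_binom :: "real \<Rightarrow> int \<Rightarrow> real" where
  "neg_binom a m = (if m < 0 then 0 else pochhammer a (nat m) / fact (nat m))"

text \<open>This is the Chu-Vandermonde identity, once the coefficient of x^m is written as (-1)^m
  times the generalized binomial of -a over m: exponents of powers of 1-x add.\<close>

lemma neg_binom_convolution:
  "(\<Sum>l\<in>{0..n}. neg_binom a (n - l) * neg_binom b l) = neg_binom (a + b) n"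
proof (cases "n < 0")
  case True
  then show ?thesis by (simp add: neg_binom_def)
next
  case False
  then obtain m where m: "n = int m"
    by (metis nonneg_int_cases not_less)
  have *: "neg_binom c (int k) = (- 1) ^ k * ((- c) gchoose k)" for c k
    by (simp add: neg_binom_def gbinomial_pochhammer power_mult_distrib [symmetric])
  have "(\<Sum>l\<in>{0..n}. neg_binom a (n - l) * neg_binom b l)
      = (\<Sum>k\<in>{0..m}. neg_binom a (n - int k) * neg_binom b (int k))"
    unfolding m by (rule sum.reindex_bij_witness [where i = int and j = nat]) auto
  also have "\<dots> = (\<Sum>k\<in>{0..m}. (- 1) ^ m * (((- b) gchoose k) * ((- a) gchoose (m - k))))"
  proof (rule sum.cong, simp)
    fix k assume "k \<in> {0..m}"
    then have "n - int k = int (m - k)" and "(- 1 :: real) ^ m = (- 1) ^ k * (- 1) ^ (m - k)"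
      by (auto simp: m power_add [symmetric])
    then show "neg_binom a (n - int k) * neg_binom b (int k)
        = (- 1) ^ m * (((- b) gchoose k) * ((- a) gchoose (m - k)))"
      by (simp add: *)
  qed
  also have "\<dots> = (- 1) ^ m * ((- b + - a) gchoose m)"
    by (simp add: sum_distrib_left [symmetric] gbinomial_Vandermonde)
  also have "\<dots> = neg_binom (a + b) n"
    by (simp add: m * algebra_simps)
  finally show ?thesis .
qed

lemma neg_binom_convolution_shift:
  assumes "0 \<le> d"
  shows "(\<Sum>l\<in>{0..n}. neg_binom a (n - l) * neg_binom b (l - d)) = neg_binom (a + b) (n - d)"
proof -
  have "(\<Sum>l\<in>{0..n}. neg_binom a (n - l) * neg_binom b (l - d))
      = (\<Sum>l\<in>{d..n}. neg_binom a (n - l) * neg_binom b (l - d))"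
    using assms by (intro sum.mono_neutral_right) (auto simp: neg_binom_def)
  also have "\<dots> = (\<Sum>l\<in>{0..n - d}. neg_binom a (n - d - l) * neg_binom b l)"
    by (rule sum.reindex_bij_witness [where i = "\<lambda>l. l + d" and j = "\<lambda>l. l - d"]) auto
  finally show ?thesis
    by (simp add: neg_binom_convolution)
qed

lemma neg_binom_0: "neg_binom 0 m = (if m = 0 then 1 else 0)"
  by (auto simp: neg_binom_def pochhammer_0_left)

lemma taylor_monomial_eq_neg_binom:
  assumes "a \<notin> \<int>\<^sub>\<le>\<^sub>0"
  shows "taylor_monomial (a - 1) k b = neg_binom a (k - b - 1)"
proof (cases "k - b \<le> 0")
  case True
  then have "(of_int (k - b) :: real) \<in> \<int>\<^sub>\<le>\<^sub>0"
    by (metis nonpos_Ints_of_int)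
  \<comment> \<open>\<open>Gamma\<close> takes the value 0 at its poles, so \<open>rising\<close> is
    a division by zero and equals 0, as does \<open>neg_binom\<close> at the negative index k - b -
    1.\<close>
  then have "Gamma (of_int (k - b) :: real) = 0"
    by (simp only: Gamma_eq_zero_iff)
  then show ?thesis
    using True by (simp add: taylor_monomial_def rising_def neg_binom_def del: of_int_diff)
next
  case False
  define m where "m = nat (k - b - 1)"
  have k: "k - b = int m + 1"
    using False by (simp add: m_def)
  have "taylor_monomial (a - 1) k b = Gamma (a + of_nat m) / fact m / Gamma a"
    using Gamma_fact [of m, where 'a = real]
    by (simp add: taylor_monomial_def rising_def k algebra_simps del: of_int_diff)
  also have "\<dots> = neg_binom a (k - b - 1)"
    using False assms by (simp add: neg_binom_def pochhammer_Gamma m_def)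
  finally show ?thesis .
qed

section \<open>Generating functions of the matrices Q\<close>

lemma Q_neg: "j < 0 \<Longrightarrow> Q M N i j = 0"
  by (induction M N i j rule: Q.induct) auto

lemma Q_Suc_Suc:
  "Q M N (Suc (Suc i)) j = M ** Q M N (Suc i) j + N ** Q M N (Suc i) (j - 1)"
  by (simp add: Q_neg)

lemma Q_0_eq_matrix_power: "Q M N (Suc i) 0 = matrix_power M i"
  by (induction i) (simp_all add: Q_neg)

text \<open>Lets left multiplication pass through finite sums and convergent series.\<close>

lemma bounded_linear_matrix_mult: "bounded_linear ((**) (A :: real ^ 'n ^ 'n))"
  unfolding linear_conv_bounded_linear [symmetric]
  by (rule linearI) (simp_all add: matrix_add_ldistrib matrix_scalar_ac scalar_matrix_assoc)

lemma matrix_vector_mult_sum_left: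
  "(\<Sum>i\<in>S. A i) *v x = (\<Sum>i\<in>S. (A i :: real ^ 'n ^ 'm) *v x)"
  by (induction S rule: infinite_finite_induct) (simp_all add: matrix_vector_mult_add_rdistrib)

text \<open>The coefficient of $x^n$ in $\sum_{j \ge 0} Q(i+1,j)\, x^{jr} (1-x)^{-b}$.\<close>

definition Q_coeff ::
    "int \<Rightarrow> real ^ 'n ^ 'n \<Rightarrow> real ^ 'n ^ 'n \<Rightarrow> real \<Rightarrow> nat \<Rightarrow> int \<Rightarrow> real ^ 'n ^ 'n" where
  "Q_coeff r M N b i n = (\<Sum>j\<in>{0..n}. neg_binom b (n - j * r) *\<^sub>R Q M N (Suc i) j)"

lemma Q_coeff_neg: "n < 0 \<Longrightarrow> Q_coeff r M N b i n = 0"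
  by (simp add: Q_coeff_def)

text \<open>Since r >= 1, a nonzero term needs j * r <= n, hence both j <= n and j <= K. The bound n
  in \<open>Q_coeff\<close> can thus be traded for the block index or for a bound common to several
  sums.\<close>

lemma neg_binom_sum_cutoff:
  assumes "0 < r" "n < (K + 1) * r" "0 \<le> K"
  shows "(\<Sum>j\<in>{0..n}. neg_binom b (n - j * r) *\<^sub>R X j) =
         (\<Sum>j\<in>{0..K}. neg_binom b (n - j * r) *\<^sub>R (X j :: 'a :: real_vector))"
proof -
  have zero: "neg_binom b (n - j * r) = 0" if "n < j \<or> K < j" "0 \<le> j" for j
  proof -
    have "n < j * r"
      using that(1)
    proof
      assume "n < j"
      moreover have "j * 1 \<le> j * r" using assms that by (intro mult_left_mono) auto
      ultimately show ?thesis by simp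
    next
      assume "K < j"
      then have "(K + 1) * r \<le> j * r" using assms by (intro mult_right_mono) auto
      with assms(2) show ?thesis by (rule less_le_trans)
    qed
    then show ?thesis by (simp add: neg_binom_def)
  qed
  have "(\<Sum>j\<in>{0..n}. neg_binom b (n - j * r) *\<^sub>R X j) =
        (\<Sum>j\<in>{0..max n K}. neg_binom b (n - j * r) *\<^sub>R X j)"
    by (rule sum.mono_neutral_left) (auto simp: zero)
  also have "\<dots> = (\<Sum>j\<in>{0..K}. neg_binom b (n - j * r) *\<^sub>R X j)"
    by (rule sum.mono_neutral_right) (auto simp: zero)
  finally show ?thesis .
qed

text \<open>At k = n + 1 - r the base point (j - 1) r gives the coefficient with index n - j r. For
  k <= 0 only j = 0 is left, with Q(i+1,0) = M^i; for k >= 1 the block condition k <= p r says n <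
  (p + 1) r, so the sum may stop at p.\<close>

lemma delayed_ML_term_eq_Q_coeff:
  assumes "0 < \<alpha>" "0 < \<beta>" "0 < r" "0 \<le> n"
  shows "delayed_ML_term \<alpha> \<beta> r M N (n + 1 - r) i = Q_coeff r M N (of_nat i * \<alpha> + \<beta>) i n"
proof -
  have "0 < of_nat i * \<alpha> + \<beta>"
    using assms by (simp add: add_nonneg_pos)
  then have "of_nat i * \<alpha> + \<beta> \<notin> \<int>\<^sub>\<le>\<^sub>0"
    using nonpos_Ints_nonpos by fastforce
  note taylor = taylor_monomial_eq_neg_binom [OF this]
  show ?thesis
  proof (cases "n + 1 - r \<le> 0")
    case True
    then show ?thesis
      using assms neg_binom_sum_cutoff [where n = n and K = 0 and r = r and X = "Q M N (Suc i)"]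
      by (simp add: delayed_ML_term_def taylor Q_coeff_def Q_0_eq_matrix_power)
  next
    case False
    define p where "p = block_index r (n + 1 - r)"
    have p: "(p - 1) * r + 1 \<le> n + 1 - r" "n + 1 - r \<le> p * r"
      using block_index_iff [OF assms(3), of "n + 1 - r" p] by (auto simp: p_def)
    have "0 < p * r" using p False by linarith
    then have "0 \<le> p" using assms by (simp add: zero_less_mult_iff)
    have "n < (p + 1) * r" using p by (simp add: algebra_simps)
    have eq: "n + 1 - r - (j - 1) * r - 1 = n - j * r" for j
      by (simp add: algebra_simps)
    show ?thesis
      using False neg_binom_sum_cutoff [OF assms(3) \<open>n < (p + 1) * r\<close> \<open>0 \<le> p\<close>, where X = "Q M N (Suc i)"]
      by (simp add: delayed_ML_term_def taylor Q_coeff_def eq p_def [symmetric])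
  qed
qed

text \<open>Only Q(1,0) = I is nonzero in the layer i = 0, and its factor is (1-x)^0 = 1. This
  supplies the term I in the equation for D.\<close>

lemma Q_coeff_0: "Q_coeff r M N 0 0 n = (if n = 0 then mat 1 else 0)"
proof (cases "n < 0")
  case True
  then show ?thesis by (simp add: Q_coeff_neg)
next
  case False
  then have "Q_coeff r M N 0 0 n = (\<Sum>j\<in>{0}. neg_binom 0 (n - j * r) *\<^sub>R Q M N (Suc 0) j)"
    unfolding Q_coeff_def by (intro sum.mono_neutral_right) auto
  then show ?thesis by (simp add: neg_binom_0)
qed

text \<open>With the exponent b held fixed this is the recursion for Q; shifting j in the N part
  produces the factor x^r.\<close>

lemma Q_coeff_Suc:
  assumes "0 < r"
  shows "Q_coeff r M N b (Suc i) n = M ** Q_coeff r M N b i n + N ** Q_coeff r M N b i (n - r)"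
proof (cases "n < 0")
  case True
  then show ?thesis using assms by (simp add: Q_coeff_neg)
next
  case False
  interpret M: bounded_linear "(**) M" by (rule bounded_linear_matrix_mult)
  interpret N: bounded_linear "(**) N" by (rule bounded_linear_matrix_mult)
  have "(\<Sum>j\<in>{0..n}. neg_binom b (n - j * r) *\<^sub>R Q M N (Suc i) (j - 1)) =
        (\<Sum>j\<in>{-1..n - 1}. neg_binom b (n - r - j * r) *\<^sub>R Q M N (Suc i) j)"
    by (rule sum.reindex_bij_witness [where i = "\<lambda>j. j + 1" and j = "\<lambda>j. j - 1"])
      (auto simp: algebra_simps)
  also have "\<dots> = (\<Sum>j\<in>{0..n - 1}. neg_binom b (n - r - j * r) *\<^sub>R Q M N (Suc i) j)"
    by (rule sum.mono_neutral_right) (auto simp: Q_neg)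
  also have "\<dots> = Q_coeff r M N b i (n - r)"
  proof -
    \<comment> \<open>\<open>Q_coeff\<close> at n - r stops at j = n - r; the surplus j satisfy j *
      r >= j > n - r and contribute 0.\<close>
    have "neg_binom b (n - r - j * r) = 0" if "n - r < j" "0 \<le> j" for j
    proof -
      have "j * 1 \<le> j * r" using assms that by (intro mult_left_mono) auto
      then show ?thesis using that by (simp add: neg_binom_def)
    qed
    then show ?thesis
      unfolding Q_coeff_def using assms by (intro sum.mono_neutral_right) auto
  qed
  finally show ?thesis
    unfolding Q_coeff_def
    by (simp del: Q.simps add: Q_Suc_Suc scaleR_add_right sum.distrib M.sum M.scaleR
        N.sum [symmetric] N.scaleR [symmetric])
qed

text \<open>Exponents add for each j separately. To swap the sums, the inner range 0..l is first
  enlarged to the common range 0..n.\<close>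

lemma Q_coeff_convolution:
  assumes "0 < r"
  shows "(\<Sum>l\<in>{0..n}. neg_binom a (n - l) *\<^sub>R Q_coeff r M N b i l) = Q_coeff r M N (a + b) i n"
proof -
  have "(\<Sum>l\<in>{0..n}. neg_binom a (n - l) *\<^sub>R Q_coeff r M N b i l) =
        (\<Sum>l\<in>{0..n}. neg_binom a (n - l) *\<^sub>R
           (\<Sum>j\<in>{0..n}. neg_binom b (l - j * r) *\<^sub>R Q M N (Suc i) j))"
  proof (rule sum.cong, simp)
    fix l assume l: "l \<in> {0..n}"
    have "n * 1 \<le> n * r" using assms l by (intro mult_left_mono) auto
    then have "l < (n + 1) * r" using assms l by (simp add: algebra_simps)
    with l assms have "Q_coeff r M N b i l =
        (\<Sum>j\<in>{0..n}. neg_binom b (l - j * r) *\<^sub>R Q M N (Suc i) j)"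
      unfolding Q_coeff_def by (intro neg_binom_sum_cutoff) auto
    then show "neg_binom a (n - l) *\<^sub>R Q_coeff r M N b i l = neg_binom a (n - l) *\<^sub>R
           (\<Sum>j\<in>{0..n}. neg_binom b (l - j * r) *\<^sub>R Q M N (Suc i) j)" by simp
  qed
  also have "\<dots> = (\<Sum>j\<in>{0..n}. \<Sum>l\<in>{0..n}.
      (neg_binom a (n - l) * neg_binom b (l - j * r)) *\<^sub>R Q M N (Suc i) j)"
    by (simp add: scaleR_sum_right) (rule sum.swap)
  also have "\<dots> = Q_coeff r M N (a + b) i n"
    unfolding Q_coeff_def using assms
    by (intro sum.cong) (simp_all add: scaleR_sum_left [symmetric] neg_binom_convolution_shift)
  finally show ?thesis .
qed

section \<open>The equation for D and the delayed system\<close>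

text \<open>The coefficient of $x^n$ in $(1-x)^\alpha D(x) = I + M D(x) + N x^r D(x)$.\<close>

lemma delayed_ML_convolution:
  fixes M N :: "real ^ 'n ^ 'n"
  assumes "0 < \<alpha>" "0 < r" "delayed_ML_convergent \<alpha> \<alpha> r M N" "0 \<le> n"
  defines "D \<equiv> (\<lambda>n. if n < 0 then 0 else delayed_ML \<alpha> \<alpha> r M N (n + 1 - r))"
  shows "(\<Sum>l\<in>{0..n}. neg_binom (- \<alpha>) (n - l) *\<^sub>R D l) =
         (if n = 0 then mat 1 else 0) + M ** D n + N ** D (n - r)"
proof -
  define T where "T i l = Q_coeff r M N (of_nat i * \<alpha> + \<alpha>) i l" for i l
  \<comment> \<open>Negative l is covered, with all terms zero, so that \<open>D (n - r)\<close>
    needs no case distinction below.\<close>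
  have D: "(\<lambda>i. T i l) sums D l" for l
  proof (cases "l < 0")
    case True
    then show ?thesis by (simp add: T_def Q_coeff_neg D_def)
  next
    case False
    then have "delayed_ML_term \<alpha> \<alpha> r M N (l + 1 - r) = (\<lambda>i. T i l)"
      using assms by (auto simp: delayed_ML_term_eq_Q_coeff T_def)
    moreover have "summable (delayed_ML_term \<alpha> \<alpha> r M N (l + 1 - r))"
      using False assms by (auto simp: delayed_ML_convergent_def)
    ultimately show ?thesis
      using False by (simp add: D_def delayed_ML_def summable_sums)
  qed
  define U where "U i = Q_coeff r M N (of_nat i * \<alpha>) i n" for i
  have U: "(\<Sum>l\<in>{0..n}. neg_binom (- \<alpha>) (n - l) *\<^sub>R T i l) = U i" for i
    by (simp add: T_def U_def Q_coeff_convolution assms)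
  \<comment> \<open>The series of \<open>U\<close> is summed twice: as a finite combination of the
    series for \<open>D l\<close>, and, with \<open>U 0\<close> split off, through the recursion in
    i. Uniqueness of the limit gives the equation.\<close>
  have "U sums (\<Sum>l\<in>{0..n}. neg_binom (- \<alpha>) (n - l) *\<^sub>R D l)"
    unfolding U [symmetric] by (intro sums_sum sums_scaleR_right D)
  moreover have "U (Suc i) = M ** T i n + N ** T i (n - r)" for i
    by (simp add: U_def T_def Q_coeff_Suc assms algebra_simps)
  then have "(\<lambda>i. U (Suc i)) sums (M ** D n + N ** D (n - r))"
    by (simp only:) (intro sums_add bounded_linear.sums [OF bounded_linear_matrix_mult] D)
  then have "U sums (M ** D n + N ** D (n - r) + U 0)"
    by (rule sums_Suc)
  moreover have "U 0 = (if n = 0 then mat 1 else 0)"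
    by (simp add: U_def Q_coeff_0)
  ultimately show ?thesis
    using sums_unique2 by (fastforce simp: algebra_simps)
qed

theorem theorem18:
  fixes \<alpha> :: real and r :: int
    and M N :: "real ^ 'n ^ 'n"
    and f z :: "int \<Rightarrow> real ^ 'n"
  assumes "0 < \<alpha>" and "\<alpha> < 1"
    and "r \<ge> 2"
    and "delayed_ML_convergent \<alpha> \<alpha> r M N"
    and "continuous_on {1..} f"
    and "\<And>k. k \<ge> 1 - r \<Longrightarrow>
           z k = nabla_integral 0 k
                   (\<lambda>s. delayed_ML \<alpha> \<alpha> r M N (k - r - rho s) *v zero_extension f s)"
  shows "(\<forall>k\<ge>1. RL_difference \<alpha> (-r) z k = M *v z k + N *v z (k - r) + f k) \<and>
         (\<forall>k\<in>{1 - r..0}. z k = 0)"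
proof -
  \<comment> \<open>The kernel argument k - r - \<open>rho s\<close> equals (k - s) + 1 - r, so the
    kernel is \<open>D (k - s)\<close> for s <= k.\<close>
  define D where "D = (\<lambda>n. if n < 0 then 0 else delayed_ML \<alpha> \<alpha> r M N (n + 1 - r))"
  \<comment> \<open>The integral is empty at k = 0; for k < 0 it runs over k+1..0, where the
    extended forcing term vanishes.\<close>
  have z0: "z k = 0" if "1 - r \<le> k" "k \<le> 0" for k
    using that by (simp add: assms(6) nabla_integral_def zero_extension_def)
  \<comment> \<open>As D vanishes at negative indices, the upper limit can be any K >= k. One K then
    serves all \<open>z s\<close> with s <= K, making the double sum below rectangular, and serves
    \<open>z (k - r)\<close> too.\<close>
  have z: "z k = (\<Sum>t\<in>{1..K}. D (k - t) *v f t)" if "1 - r \<le> k" "k \<le> K" for k K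
  proof (cases "k \<le> 0")
    case True
    then show ?thesis using that by (simp add: z0 D_def)
  next
    case False
    have "z k = (\<Sum>t\<in>{1..k}. D (k - t) *v f t)"
      using False that
      by (auto simp: assms(6) nabla_integral_def zero_extension_def D_def rho_def algebra_simps
          intro!: sum.cong)
    also have "\<dots> = (\<Sum>t\<in>{1..K}. D (k - t) *v f t)"
      using that by (intro sum.mono_neutral_left) (auto simp: D_def)
    finally show ?thesis .
  qed
  have "RL_difference \<alpha> (-r) z k = M *v z k + N *v z (k - r) + f k" if k: "1 \<le> k" for k
  proof -
    \<comment> \<open>The order lies strictly between -1 and 0, so it avoids the poles of
      \<open>Gamma\<close>.\<close>
    have "- \<alpha> \<noteq> of_int m" for m
    proof
      assume m: "- \<alpha> = of_int m"
      then have "of_int (- 1) < (of_int m :: real)" "of_int m < (of_int 0 :: real)"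
        using assms(1,2) by auto
      then show False unfolding of_int_less_iff by simp
    qed
    then have "- \<alpha> \<notin> \<int>\<^sub>\<le>\<^sub>0"
      by (auto elim: nonpos_Ints_cases)
    then have monomial: "taylor_monomial (- \<alpha> - 1) k (rho s) = neg_binom (- \<alpha>) (k - s)" for s
      by (simp add: taylor_monomial_eq_neg_binom rho_def)
    \<comment> \<open>For fixed t, the substitution l = s - t turns this into the equation for D at
      index k - t; its unit term survives only at t = k and yields \<open>f k\<close>.\<close>
    have inner: "(\<Sum>s\<in>{1..k}. neg_binom (- \<alpha>) (k - s) *\<^sub>R D (s - t)) =
        (if k = t then mat 1 else 0) + M ** D (k - t) + N ** D (k - r - t)"
      if t: "t \<in> {1..k}" for t
    proof -
      have "(\<Sum>s\<in>{1..k}. neg_binom (- \<alpha>) (k - s) *\<^sub>R D (s - t)) =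
            (\<Sum>s\<in>{t..k}. neg_binom (- \<alpha>) (k - s) *\<^sub>R D (s - t))"
        using t by (intro sum.mono_neutral_right) (auto simp: D_def)
      also have "\<dots> = (\<Sum>l\<in>{0..k - t}. neg_binom (- \<alpha>) (k - t - l) *\<^sub>R D l)"
        by (rule sum.reindex_bij_witness [where i = "\<lambda>l. l + t" and j = "\<lambda>s. s - t"]) auto
      also have "\<dots> = (if k - t = 0 then mat 1 else 0) + M ** D (k - t) + N ** D (k - t - r)"
        unfolding D_def using t assms by (intro delayed_ML_convolution) auto
      finally show ?thesis by (simp add: algebra_simps)
    qed
    \<comment> \<open>The difference starts at 1 - r, but z vanishes on 1 - r..0.\<close>
    have "RL_difference \<alpha> (-r) z k = (\<Sum>s\<in>{1..k}. neg_binom (- \<alpha>) (k - s) *\<^sub>R z s)"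
      unfolding RL_difference_def monomial
      using assms(3) by (intro sum.mono_neutral_right) (auto simp: z0)
    also have "\<dots> = (\<Sum>s\<in>{1..k}. \<Sum>t\<in>{1..k}. (neg_binom (- \<alpha>) (k - s) *\<^sub>R D (s - t)) *v f t)"
      using assms(3)
      by (intro sum.cong) (auto simp: z [where K = k] scaleR_sum_right scaleR_matrix_vector_assoc)
    also have "\<dots> = (\<Sum>t\<in>{1..k}. (\<Sum>s\<in>{1..k}. neg_binom (- \<alpha>) (k - s) *\<^sub>R D (s - t)) *v f t)"
      by (subst sum.swap) (simp add: matrix_vector_mult_sum_left)
    also have "\<dots> = (\<Sum>t\<in>{1..k}. (if k = t then f t else 0) + M *v (D (k - t) *v f t)
        + N *v (D (k - r - t) *v f t))"
      by (intro sum.cong)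
        (simp_all add: inner matrix_vector_mult_add_rdistrib matrix_vector_mul_assoc)
    also have "\<dots> = f k + M *v z k + N *v z (k - r)"
      using k assms(3)
      by (simp add: sum.distrib z [where K = k]
          linear_sum [OF matrix_vector_mul_linear] sum.delta')
    finally show ?thesis by (simp add: algebra_simps)
  qed
  then show ?thesis using z0 by auto
qed

end
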